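(* Consider $\dot{\mathbf x}=A\mathbf x$, $\mathbf x\in\mathbb R^n$, with eigenvalues of $A$ listed with multiplicity so that $\lambda_1,\dots,\lambda_u$ have positive real part, $\lambda_{u+1},\dots,\lambda_{u+c}$ have zero real part, and $\lambda_{u+c+1},\dots,\lambda_{u+c+s}$ have negative real part ($u+c+s=n$). Let $\phi_1,\dots,\phi_{u+c+s}$ be the corresponding (generalized) eigenfunctions of the associated Koopman operator. Then $$L_s=\{\mathbf x\in\mathbb R^n\mid \phi_1(\mathbf x)=0,\dots,\phi_{u+c}(\mathbf x)=0\}$$ is the stable subspace $E^s$, $$L_c=\{\mathbf x\in\mathbb R^n\mid \phi_1(\mathbf x)=0,\dots,\phi_u(\mathbf x)=0,\ \phi_{u+c+1}(\mathbf x)=0,\dots,\phi_{u+c+s}(\mathbf x)=0\}$$ is the center subspace $E^c$, and $$L_u=\{\mathbf x\in\mathbb R^n\mid \phi_{u+c+1}(\mathbf x)=0,\dots,\phi_{u+c+s}(\mathbf x)=0\}$$ is the unstable subspace $E^u$.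
   Context: The (generalized) Koopman eigenfunctions of $\dot{\mathbf x}=A\mathbf x$ are the linear functionals $\phi_j(\mathbf x)=\langle\mathbf x,\mathbf w_j\rangle$, where $\{\mathbf w_j\}$ is the basis dual (for the Hermitian inner product) to a Jordan basis $\{\mathbf v_j\}$ of (generalized) eigenvectors of $A$, and $\phi_j$ is associated with the eigenvalue $\lambda_j$ of $\mathbf v_j$. The stable subspace $E^s$ is the set of points of $\mathbb R^n$ whose trajectories converge to $0$ as $t\to\infty$ (equivalently, the real subspace spanned by generalized eigenvectors with negative real part eigenvalues); the unstable subspace $E^u$ is the set of points whose trajectories converge to $0$ as $t\to-\infty$ (span of generalized eigenvectors with positive real part eigenvalues); the center subspace $E^c$ is the span of the generalized eigenvectors whose eigenvalues have zero real part (real points of the complex span).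
   Formalization: The printed L_u is false when c > 0 (for n=1, A=0 it is all of R, but E^u={0}); the formal statement instead takes L_u to be the common zero set of φ_{u+1},…,φ_{u+c+s}, which agrees with the printed set when c = 0. *)

theory Defs
  imports "HOL-Analysis.Analysis"
begin

definition cvec :: "real^'n \<Rightarrow> complex^'n" where
  "cvec x = (\<chi> i. complex_of_real (x $ i))"

definition cmat :: "real^'n^'m \<Rightarrow> complex^'n^'m" where
  "cmat A = map_matrix complex_of_real A"

text \<open>The library's \<open>inner\<close> on \<open>complex^'n\<close> is the real inner product. The Hermitian one below is
  linear in its first argument, so that the functionals \<open>x \<mapsto> hinner x w\<close> are linear.\<close>

definition hinner :: "complex^'n \<Rightarrow> complex^'n \<Rightarrow> complex" where
  "hinner x y = (\<Sum>i\<in>UNIV. x $ i * cnj (y $ i))"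

definition generalized_eigenvector :: "complex^'n^'n \<Rightarrow> complex \<Rightarrow> complex^'n \<Rightarrow> bool" where
  "generalized_eigenvector M \<mu> y \<longleftrightarrow>
     y \<noteq> 0 \<and> (\<exists>k. ((\<lambda>z. M *v z - \<mu> *s z) ^^ k) y = 0)"

text \<open>Families of vectors are indexed by \<open>{1..CARD('n)}\<close>; values at other indices are irrelevant.
  The last condition says that the matrix with columns \<open>v 1, v 2, \<dots>\<close> brings \<open>M\<close> to Jordan normal
  form, with diagonal \<open>lam 1, lam 2, \<dots>\<close> and the ones just above it. In particular the \<open>lam j\<close> are
  the eigenvalues of \<open>M\<close> listed with algebraic multiplicity.\<close>

definition jordan_basis :: "complex^'n^'n \<Rightarrow> (nat \<Rightarrow> complex) \<Rightarrow> (nat \<Rightarrow> complex^'n) \<Rightarrow> bool" where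
  "jordan_basis M lam v \<longleftrightarrow>
     inj_on v {1..CARD('n)} \<and>
     vec.independent (v ` {1..CARD('n)}) \<and>
     vec.span (v ` {1..CARD('n)}) = UNIV \<and>
     (\<forall>j\<in>{1..CARD('n)}.
        M *v v j = lam j *s v j \<or>
        (1 < j \<and> lam (j - 1) = lam j \<and> M *v v j = lam j *s v j + v (j - 1)))"

definition dual_basis :: "(nat \<Rightarrow> complex^'n) \<Rightarrow> (nat \<Rightarrow> complex^'n) \<Rightarrow> bool" where
  "dual_basis v w \<longleftrightarrow>
     (\<forall>i\<in>{1..CARD('n)}. \<forall>j\<in>{1..CARD('n)}. hinner (v i) (w j) = (if i = j then 1 else 0))"

text \<open>\<open>koopman_eigenfunctions A lam \<phi>\<close>: the \<open>\<phi> j\<close> are the (generalized) Koopman eigenfunctions of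
  \<open>x' = A x\<close> obtained from some Jordan basis of \<open>A\<close>, with \<open>\<phi> j\<close> associated with \<open>lam j\<close>.\<close>

definition koopman_eigenfunctions ::
    "real^'n^'n \<Rightarrow> (nat \<Rightarrow> complex) \<Rightarrow> (nat \<Rightarrow> real^'n \<Rightarrow> complex) \<Rightarrow> bool" where
  "koopman_eigenfunctions A lam \<phi> \<longleftrightarrow>
     (\<exists>v w. jordan_basis (cmat A) lam v \<and> dual_basis v w \<and>
        (\<forall>j\<in>{1..CARD('n)}. \<forall>x. \<phi> j x = hinner (cvec x) (w j)))"

definition trajectory :: "real^'n^'n \<Rightarrow> (real \<Rightarrow> real^'n) \<Rightarrow> bool" where
  "trajectory A x \<longleftrightarrow> (\<forall>t. (x has_vector_derivative A *v x t) (at t))"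

text \<open>Each point lies on exactly one trajectory, so the existential quantifiers below just pick
  the trajectory of the point.\<close>

definition stable_subspace :: "real^'n^'n \<Rightarrow> (real^'n) set" where
  "stable_subspace A = {p. \<exists>x. trajectory A x \<and> x 0 = p \<and> (x \<longlongrightarrow> 0) at_top}"

definition unstable_subspace :: "real^'n^'n \<Rightarrow> (real^'n) set" where
  "unstable_subspace A = {p. \<exists>x. trajectory A x \<and> x 0 = p \<and> (x \<longlongrightarrow> 0) at_bot}"

definition center_subspace :: "real^'n^'n \<Rightarrow> (real^'n) set" where
  "center_subspace A =
     {p. cvec p \<in> vec.span {y. \<exists>\<mu>. generalized_eigenvector (cmat A) \<mu> y \<and> Re \<mu> = 0}}"

end

theory Submission
  imports Defs "HOL-Real_Asymp.Real_Asymp"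
begin

text \<open>In the coordinates \<open>z j = hinner x (w j)\<close> dual to a Jordan basis the equation becomes
  \<open>z j' = lam j * z j + e (j + 1) * z (j + 1)\<close>, with \<open>lam (j + 1) = lam j\<close> whenever the coupling
  \<open>e (j + 1)\<close> is nonzero. Going down the chains, a solution tending to \<open>0\<close> at \<open>+\<infinity>\<close> has \<open>z j = 0\<close>
  whenever \<open>Re (lam j) \<ge> 0\<close>. Conversely, a generalized eigenvector \<open>y\<close> for \<open>\<mu>\<close> with \<open>Re \<mu> < 0\<close> is the
  initial value of the decaying solution \<open>exp (t \<mu>) (\<Sum>i. t ^ i / i! (M - \<mu>) ^ i y)\<close>, and real parts of
  complex solutions solve the real system. The unstable case is the stable one for \<open>- A\<close>.\<close>

section \<open>Complexification and the Hermitian product\<close>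

lemma cvec_component [simp]: "cvec x $ i = complex_of_real (x $ i)"
  by (simp add: cvec_def)

lemma cvec_zero [simp]: "cvec 0 = 0"
  by (simp add: vec_eq_iff)

lemma linear_cvec: "linear cvec"
  by (rule linearI) (simp_all add: vec_eq_iff complex_eq_iff)

lemma cvec_matrix_vector_mult: "cvec (A *v x) = cmat A *v cvec x"
  by (simp add: vec_eq_iff matrix_vector_mult_def cmat_def map_matrix_def)

lemma cmat_uminus: "cmat (- A) = - cmat A"
  by (simp add: vec_eq_iff cmat_def map_matrix_def)

lemma uminus_matrix_vector_mult: "- A *v x = - (A *v x)" for A :: "'a::comm_ring_1^'n^'m"
  by (simp add: vec_eq_iff matrix_vector_mult_def sum_negf)

lemma hinner_zero_left [simp]: "hinner 0 y = 0"
  by (simp add: hinner_def)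

lemma hinner_add_left: "hinner (x + y) z = hinner x z + hinner y z"
  by (simp add: hinner_def algebra_simps sum.distrib)

lemma hinner_diff_left: "hinner (x - y) z = hinner x z - hinner y z"
  by (simp add: hinner_def algebra_simps sum_subtractf)

lemma hinner_smult_left: "hinner (a *s x) y = a * hinner x y"
  by (simp add: hinner_def sum_distrib_left algebra_simps)

lemma linear_hinner_left: "linear (\<lambda>x. hinner x y)"
  by (rule linearI)
    (simp_all only: hinner_add_left, simp add: hinner_def scaleR_sum_right)

lemma bounded_linear_hinner_cvec: "bounded_linear (\<lambda>x. hinner (cvec x) y)"
  using linear_compose[OF linear_cvec linear_hinner_left]
  by (simp add: o_def linear_conv_bounded_linear)

lemma bounded_linear_smult_right: "bounded_linear (\<lambda>c. c *s (y :: complex^'n))"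
  unfolding linear_conv_bounded_linear[symmetric]
  by (rule linearI) (simp_all add: vec_eq_iff algebra_simps)

definition Re_vec :: "complex^'n \<Rightarrow> real^'n" where
  "Re_vec y = (\<chi> i. Re (y $ i))"

lemma bounded_linear_Re_vec: "bounded_linear Re_vec"
  unfolding linear_conv_bounded_linear[symmetric]
  by (rule linearI) (simp_all add: vec_eq_iff Re_vec_def)

lemma Re_vec_cvec [simp]: "Re_vec (cvec x) = x"
  by (simp add: vec_eq_iff Re_vec_def)

text \<open>Holds because \<open>cmat A\<close> has real entries; it makes the real part of a
  complex solution a trajectory of \<open>A\<close>.\<close>

lemma Re_vec_cmat_mult: "Re_vec (cmat A *v y) = A *v Re_vec y"
  by (simp add: vec_eq_iff matrix_vector_mult_def cmat_def map_matrix_def Re_vec_def)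

section \<open>Scalar equations and decaying solutions\<close>

text \<open>The integrating factor exp (- t a) makes \<open>g\<close> constant. For
  \<open>Re a \<ge> 0\<close> and \<open>t \<ge> 0\<close> this factor has norm at most 1, so
  \<open>g\<close> also tends to 0 and the constant is 0.\<close>

lemma linear_ode_zero_if_tendsto_zero:
  fixes z :: "real \<Rightarrow> complex"
  assumes deriv: "\<And>t. (z has_vector_derivative a * z t) (at t)"
    and lim: "(z \<longlongrightarrow> 0) at_top" and "Re a \<ge> 0"
  shows "z t = 0"
proof -
  define g where "g t = exp (- (of_real t * a)) * z t" for t
  have "(g has_vector_derivative 0) (at t)" for t
  proof -
    have "((\<lambda>z. exp (- (z * a))) has_field_derivative - a * exp (- (of_real t * a))) (at (of_real t))"
      by (auto intro!: derivative_eq_intros)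
    from has_vector_derivative_mult[OF has_vector_derivative_real_field[OF this] deriv]
    show ?thesis by (simp add: g_def[abs_def] algebra_simps)
  qed
  then have const: "g t = g 0" for t
    by (metis UNIV_I convex_UNIV has_vector_derivative_zero_constant has_vector_derivative_at_within)
  have bound: "norm (g t) \<le> norm (z t)" if "t \<ge> 0" for t
    using that \<open>Re a \<ge> 0\<close> by (simp add: g_def norm_mult mult_left_le_one_le)
  have "(g \<longlongrightarrow> 0) at_top"
    by (rule Lim_null_comparison[OF _ tendsto_norm_zero[OF lim]])
      (use bound in \<open>auto intro: eventually_at_top_linorderI[of 0]\<close>)
  moreover have "(g \<longlongrightarrow> g 0) at_top"
    by (intro tendsto_eventually always_eventually allI const)
  ultimately have "g 0 = 0" by (intro tendsto_unique[OF trivial_limit_at_top_linorder])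
  with const[of t] show ?thesis by (simp add: g_def)
qed

lemma tendsto_power_mult_exp_zero:
  assumes "Re a < 0"
  shows "((\<lambda>t::real. of_real t ^ k * exp (of_real t * a)) \<longlongrightarrow> 0) at_top"
proof (rule Lim_null_comparison)
  show "\<forall>\<^sub>F t in at_top. norm (of_real t ^ k * exp (of_real t * a)) \<le> t ^ k * exp (t * Re a)"
    by (intro eventually_at_top_linorderI[of 0]) (simp add: norm_mult norm_power)
  show "((\<lambda>t. t ^ k * exp (t * Re a)) \<longlongrightarrow> 0) at_top"
    using assms by real_asymp
qed

lemma generalized_eigenvector_solution:
  fixes M :: "complex^'n^'n"
  assumes "generalized_eigenvector M \<mu> y" "Re \<mu> < 0"
  shows "\<exists>Y. (\<forall>t. (Y has_vector_derivative M *v Y t) (at t)) \<and> Y 0 = y \<and> (Y \<longlongrightarrow> 0) at_top"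
proof -
  define N where "N z = M *v z - \<mu> *s z" for z
  obtain k where k: "(N ^^ k) y = 0"
    using assms by (auto simp: generalized_eigenvector_def N_def[abs_def])
  define c where "c i t = of_real t ^ i / fact i * exp (of_real t * \<mu>)" for i t
  \<comment> \<open>This is exp (t M) y: the factor exp (t \<mu>) splits off and the series of exp
    (t N) y terminates. The last summand is zero; keeping it makes the index shift below work
    without a boundary term.\<close>
  define Y where "Y t = (\<Sum>i<Suc k. c i t *s (N ^^ i) y)" for t
  have c_deriv: "(c i has_vector_derivative (\<mu> * c i t + (if i = 0 then 0 else c (i - 1) t))) (at t)" for i t
  proof -
    \<comment> \<open>Differentiated in a complex variable first, then restricted to the real
      line.\<close>
    have "((\<lambda>z. z ^ i / fact i * exp (z * \<mu>)) has_field_derivative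
        (\<mu> * c i t + (if i = 0 then 0 else c (i - 1) t))) (at (of_real t))"
    proof (rule DERIV_cong)
      show "((\<lambda>z. z ^ i / fact i * exp (z * \<mu>)) has_field_derivative
          of_nat i * of_real t ^ (i - 1) / fact i * exp (of_real t * \<mu>)
            + exp (of_real t * \<mu>) * \<mu> * (of_real t ^ i / fact i)) (at (of_real t))"
        using DERIV_power[OF DERIV_ident, of i "of_real t :: complex" UNIV]
        by (intro DERIV_mult DERIV_cdivide) (auto intro!: derivative_eq_intros)
    qed (cases i, simp_all add: c_def del: of_nat_Suc)
    then show ?thesis
      unfolding c_def[abs_def] by (rule has_vector_derivative_real_field)
  qed
  have "(Y has_vector_derivative M *v Y t) (at t)" for t
  proof -
    have "(Y has_vector_derivative
        (\<Sum>i<Suc k. (\<mu> * c i t + (if i = 0 then 0 else c (i - 1) t)) *s (N ^^ i) y)) (at t)"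
      unfolding Y_def
      by (intro has_vector_derivative_sum
          bounded_linear.has_vector_derivative[OF bounded_linear_smult_right c_deriv])
    moreover have "(\<Sum>i<Suc k. (if i = 0 then 0 else c (i - 1) t) *s (N ^^ i) y) =
        (\<Sum>i<Suc k. c i t *s N ((N ^^ i) y))"
      by (subst sum.lessThan_Suc_shift) (simp add: k N_def)
    moreover have "M *v Y t = (\<Sum>i<Suc k. (\<mu> * c i t) *s (N ^^ i) y) + (\<Sum>i<Suc k. c i t *s N ((N ^^ i) y))"
      unfolding Y_def vec.sum sum.distrib[symmetric]
      by (intro sum.cong refl) (simp add: N_def vec.scale vec.scale_right_diff_distrib mult.commute)
    ultimately show ?thesis
      by (simp only: vec.scale_left_distrib sum.distrib)
  qed
  moreover have "Y 0 = y"
    unfolding Y_def by (subst sum.lessThan_Suc_shift) (simp add: c_def)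
  moreover have "(Y \<longlongrightarrow> 0) at_top"
  proof -
    have "(c i \<longlongrightarrow> 0) at_top" for i
      using tendsto_divide[OF tendsto_power_mult_exp_zero[OF assms(2)] tendsto_const[of "fact i"]]
      by (simp add: c_def[abs_def])
    then show ?thesis
      unfolding Y_def
      by (intro tendsto_null_sum bounded_linear.tendsto_zero[OF bounded_linear_smult_right])
  qed
  ultimately show ?thesis by blast
qed

section \<open>Time reversal\<close>

lemma trajectory_reverse:
  assumes "trajectory A x"
  shows "trajectory (- A) (\<lambda>t. x (- t))"
  unfolding trajectory_def
proof
  fix t
  have "((x \<circ> uminus) has_vector_derivative (- 1) *\<^sub>R (A *v x (- t))) (at t)"
    by (rule vector_diff_chain_at)
      (use assms in \<open>auto intro!: derivative_eq_intros simp: trajectory_def\<close>)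
  then show "((\<lambda>t. x (- t)) has_vector_derivative - A *v x (- t)) (at t)"
    by (simp add: o_def uminus_matrix_vector_mult)
qed

lemma stable_subspace_uminus: "stable_subspace (- A) = unstable_subspace A"
proof -
  have "(\<exists>x. trajectory (- A) x \<and> x 0 = p \<and> (x \<longlongrightarrow> 0) at_top) \<longleftrightarrow>
      (\<exists>x. trajectory A x \<and> x 0 = p \<and> (x \<longlongrightarrow> 0) at_bot)" for p
  proof (intro iffI; elim exE conjE)
    fix x assume "trajectory (- A) x" "x 0 = p" "(x \<longlongrightarrow> 0) at_top"
    then show "\<exists>x. trajectory A x \<and> x 0 = p \<and> (x \<longlongrightarrow> 0) at_bot"
      using trajectory_reverse[of "- A" x]
      by (intro exI[of _ "\<lambda>t. x (- t)"]) (simp add: filterlim_at_top_mirror)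
  next
    fix x assume "trajectory A x" "x 0 = p" "(x \<longlongrightarrow> 0) at_bot"
    then show "\<exists>x. trajectory (- A) x \<and> x 0 = p \<and> (x \<longlongrightarrow> 0) at_top"
      using trajectory_reverse[of A x]
      by (intro exI[of _ "\<lambda>t. x (- t)"]) (simp add: filterlim_at_bot_mirror)
  qed
  then show ?thesis by (simp only: stable_subspace_def unstable_subspace_def)
qed

section \<open>Coordinates dual to a Jordan basis\<close>

text \<open>Scalars \<open>e j\<close> instead of ones above the diagonal make the setting invariant under \<open>M \<mapsto> - M\<close>,
  that is, under time reversal.\<close>

locale dual_jordan_bases =
  fixes M :: "complex^'n^'n" and lam e :: "nat \<Rightarrow> complex" and v w :: "nat \<Rightarrow> complex^'n"
  assumes dual: "dual_basis v w"
    and span: "vec.span (v ` {1..CARD('n)}) = UNIV"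
    and chain: "j \<in> {1..CARD('n)} \<Longrightarrow> M *v v j = lam j *s v j + e j *s v (j - 1)"
    and superdiag: "e j \<noteq> 0 \<Longrightarrow> j \<in> {2..CARD('n)} \<and> lam (j - 1) = lam j"
begin

lemma hinner_basis:
  "i \<in> {1..CARD('n)} \<Longrightarrow> j \<in> {1..CARD('n)} \<Longrightarrow> hinner (v i) (w j) = (if i = j then 1 else 0)"
  using dual by (auto simp: dual_basis_def)

text \<open>Both sides are linear in \<open>y\<close>, so it suffices to check basis vectors, where
  duality applies.\<close>

lemma expansion: "(\<Sum>j=1..CARD('n). hinner y (w j) *s v j) = y"
proof -
  have "y \<in> vec.span (v ` {1..CARD('n)})" unfolding span ..
  then show ?thesis
  proof (induction rule: vec.span_induct_alt)
    case base
    then show ?case by simp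
  next
    case (step a x y)
    then obtain i where i: "i \<in> {1..CARD('n)}" "x = v i" by auto
    have "(\<Sum>j=1..CARD('n). hinner (v i) (w j) *s v j) = (\<Sum>j=1..CARD('n). if i = j then v j else 0)"
      using i by (intro sum.cong) (auto simp: hinner_basis)
    also have "\<dots> = v i" using i by simp
    finally have "(\<Sum>j=1..CARD('n). a *s (hinner x (w j) *s v j)) = a *s x"
      using i(2) by (simp only: flip: vec.scale_sum_right)
    with step show ?case
      by (simp add: hinner_add_left hinner_smult_left vec.scale_left_distrib sum.distrib)
  qed
qed

text \<open>\<open>M\<close> sends \<open>v (Suc j)\<close> partly to \<open>v j\<close>, so
  coordinate \<open>j\<close> receives coordinate \<open>Suc j\<close>: dual chains run the opposite
  way. For \<open>j = CARD('n)\<close> the value \<open>w (Suc j)\<close> is arbitrary, but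
  \<open>superdiag\<close> makes its coefficient 0.\<close>

lemma hinner_mult_dual:
  assumes j: "j \<in> {1..CARD('n)}"
  shows "hinner (M *v y) (w j) = lam j * hinner y (w j) + e (Suc j) * hinner y (w (Suc j))"
proof -
  have "y \<in> vec.span (v ` {1..CARD('n)})" unfolding span ..
  then show ?thesis
  proof (induction rule: vec.span_induct_alt)
    case base
    then show ?case by simp
  next
    case (step a x y)
    then obtain i where i: "i \<in> {1..CARD('n)}" "x = v i" by auto
    have "hinner (M *v v i) (w j) = lam j * hinner (v i) (w j) + e (Suc j) * hinner (v i) (w (Suc j))"
    proof -
      \<comment> \<open>For \<open>i = 1\<close> the vector \<open>v 0\<close> is arbitrary, but
        then \<open>e i = 0\<close>.\<close>
      have "hinner (v (i - 1)) (w j) = (if i = Suc j then 1 else 0)" if "i \<ge> 2"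
        using hinner_basis[of "i - 1" j] i j that by (cases i) auto
      then have "e i * hinner (v (i - 1)) (w j) = e (Suc j) * hinner (v i) (w (Suc j))"
        using superdiag[of i] superdiag[of "Suc j"] i j
        by (cases "e i = 0"; cases "e (Suc j) = 0") (auto simp: hinner_basis)
      then show ?thesis
        using i j by (simp add: chain hinner_add_left hinner_smult_left hinner_basis)
    qed
    with step i show ?case
      by (simp add: hinner_add_left hinner_smult_left matrix_vector_right_distrib
          vec.scale algebra_simps)
  qed
qed

text \<open>Downward induction from the last index. Where the coupling is nonzero, the equal
  eigenvalues let assumptions on \<open>lam j\<close> pass to the next index; where it is zero, the
  coupled term disappears anyway.\<close>

lemma chain_induct [consumes 1, case_names step]:
  assumes "j \<in> {1..CARD('n)}"
    and "\<And>j. j \<in> {1..CARD('n)} \<Longrightarrow> (e (Suc j) \<noteq> 0 \<Longrightarrow> lam (Suc j) = lam j \<and> P (Suc j)) \<Longrightarrow> P j"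
  shows "P j"
  using assms(1)
proof (induction "CARD('n) - j" arbitrary: j rule: less_induct)
  case less
  show ?case
  proof (rule assms(2))
    assume "e (Suc j) \<noteq> 0"
    with superdiag[of "Suc j"] less show "lam (Suc j) = lam j \<and> P (Suc j)" by auto
  qed (use less in auto)
qed

text \<open>\<open>M - lam j\<close> kills \<open>v j\<close> or lowers it to a multiple of
  \<open>v (j - 1)\<close> with the same eigenvalue, so \<open>j\<close> applications reach
  0.\<close>

lemma generalized_eigenvector_basis:
  assumes "j \<in> {1..CARD('n)}"
  shows "generalized_eigenvector M (lam j) (v j)"
proof -
  have "v j \<noteq> 0" using hinner_basis[OF assms assms] by auto
  moreover have "((\<lambda>z. M *v z - lam j *s z) ^^ j) (v j) = 0"
    using assms
  proof (induction j)
    case (Suc j)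
    define N where "N z = M *v z - lam (Suc j) *s z" for z
    have N_scale: "(N ^^ i) (a *s z) = a *s (N ^^ i) z" for i a z
      by (induction i) (simp_all add: N_def vec.scale algebra_simps vec.scale_right_diff_distrib)
    have "N (v (Suc j)) = e (Suc j) *s v j"
      using chain[OF Suc.prems] by (simp add: N_def)
    moreover have "e (Suc j) *s (N ^^ j) (v j) = 0"
      using superdiag[of "Suc j"] Suc.IH by (cases "e (Suc j) = 0") (auto simp: N_def[abs_def])
    ultimately have "(N ^^ Suc j) (v (Suc j)) = 0"
      by (simp add: funpow_swap1 N_scale)
    then show ?case by (simp only: N_def[abs_def])
  qed simp
  ultimately show ?thesis by (auto simp: generalized_eigenvector_def)
qed

text \<open>The functional of \<open>w j\<close> is a generalized left eigenvector for
  \<open>lam j\<close>, hence vanishes on the generalized eigenspaces of all other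
  eigenvalues.\<close>

lemma hinner_generalized_eigenvector:
  assumes "j \<in> {1..CARD('n)}" "generalized_eigenvector M \<mu> y" "lam j \<noteq> \<mu>"
  shows "hinner y (w j) = 0"
proof -
  define N where "N z = M *v z - \<mu> *s z" for z
  \<comment> \<open>Stated for every vector killed by a power of \<open>N\<close>, zero included,
    since the inner induction on \<open>k\<close> replaces \<open>y\<close> by
    \<open>N y\<close>.\<close>
  have "\<forall>y. (\<exists>k. (N ^^ k) y = 0) \<longrightarrow> hinner y (w j) = 0"
    using assms(1,3)
  proof (induction rule: chain_induct)
    case (step j)
    have "hinner y (w j) = 0" if "(N ^^ k) y = 0" for k y
      using that
    proof (induction k arbitrary: y)
      case (Suc k)
      have "(N ^^ k) (N y) = 0" using Suc.prems by (simp add: funpow_swap1)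
      then have "hinner (N y) (w j) = 0" by (rule Suc.IH)
      moreover have "e (Suc j) * hinner y (w (Suc j)) = 0"
        using step Suc.prems by (cases "e (Suc j) = 0") (auto simp del: funpow.simps)
      \<comment> \<open>The left side and the coupling term are 0, and \<open>lam j - \<mu>\<close>
        is a nonzero factor.\<close>
      moreover have "hinner (N y) (w j) =
          (lam j - \<mu>) * hinner y (w j) + e (Suc j) * hinner y (w (Suc j))"
        using step by (simp add: N_def hinner_diff_left hinner_smult_left hinner_mult_dual algebra_simps)
      ultimately show ?case using step.prems by simp
    qed simp
    then show ?case by blast
  qed
  then show ?thesis
    using assms(2) by (auto simp: generalized_eigenvector_def N_def[abs_def])
qed

section \<open>Invariant subspaces as zero sets of coordinates\<close>

text \<open>The functionals with \<open>Re (lam j) \<noteq> 0\<close> vanish on the generators.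
  Conversely, the expansion of \<open>y\<close> keeps only vectors \<open>v j\<close> that are
  generators themselves.\<close>

lemma center_iff:
  "y \<in> vec.span {y. \<exists>\<mu>. generalized_eigenvector M \<mu> y \<and> Re \<mu> = 0} \<longleftrightarrow>
    (\<forall>j\<in>{1..CARD('n)}. Re (lam j) \<noteq> 0 \<longrightarrow> hinner y (w j) = 0)"
  (is "y \<in> vec.span ?E \<longleftrightarrow> ?R")
proof
  assume "y \<in> vec.span ?E"
  then show ?R
  proof (induction rule: vec.span_induct_alt)
    case base
    then show ?case by simp
  next
    case (step a x y)
    have "hinner x (w j) = 0" if "j \<in> {1..CARD('n)}" "Re (lam j) \<noteq> 0" for j
      using step(1) that hinner_generalized_eigenvector[OF that(1)] by blast
    with step(2) show ?case by (simp add: hinner_add_left hinner_smult_left)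
  qed
next
  assume R: ?R
  have "hinner y (w j) *s v j \<in> vec.span ?E" if j: "j \<in> {1..CARD('n)}" for j
  proof (cases "Re (lam j) = 0")
    case True
    with generalized_eigenvector_basis[OF j] show ?thesis
      by (intro vec.span_scale vec.span_base) auto
  qed (use R j in \<open>simp add: vec.span_zero\<close>)
  then have "(\<Sum>j=1..CARD('n). hinner y (w j) *s v j) \<in> vec.span ?E"
    by (rule vec.span_sum)
  then show "y \<in> vec.span ?E" by (simp only: expansion)
qed

lemma stable_subspace_eq:
  assumes M: "M = cmat A"
  shows "stable_subspace A =
    {x. \<forall>j\<in>{1..CARD('n)}. Re (lam j) \<ge> 0 \<longrightarrow> hinner (cvec x) (w j) = 0}"
proof (intro equalityI subsetI CollectI ballI impI)
  fix p j
  assume "p \<in> stable_subspace A" and j: "j \<in> {1..CARD('n)}" "0 \<le> Re (lam j)"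
  then obtain x where x: "\<And>t. (x has_vector_derivative A *v x t) (at t)" "x 0 = p"
      "(x \<longlongrightarrow> 0) at_top"
    by (auto simp: stable_subspace_def trajectory_def)
  define z where "z j t = hinner (cvec (x t)) (w j)" for j t
  have "\<forall>t. z j t = 0"
    using j
  proof (induction rule: chain_induct)
    case (step j)
    \<comment> \<open>The next coordinate of the chain vanishes by induction, so the equation for
      \<open>z j\<close> decouples.\<close>
    have "e (Suc j) * z (Suc j) t = 0" for t
      using step by (cases "e (Suc j) = 0") auto
    moreover have "(z j has_vector_derivative hinner (cvec (A *v x t)) (w j)) (at t)" for t
      unfolding z_def
      by (rule bounded_linear.has_vector_derivative[OF bounded_linear_hinner_cvec x(1)])
    moreover have "hinner (cvec (A *v x t)) (w j) = lam j * z j t + e (Suc j) * z (Suc j) t" for t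
      using step(1) by (simp add: cvec_matrix_vector_mult hinner_mult_dual z_def flip: M)
    ultimately have "(z j has_vector_derivative lam j * z j t) (at t)" for t
      by (metis add.right_neutral)
    moreover have "(z j \<longlongrightarrow> 0) at_top"
      using bounded_linear.tendsto[OF bounded_linear_hinner_cvec x(3)]
      by (simp add: z_def[abs_def])
    ultimately show ?case
      using linear_ode_zero_if_tendsto_zero step.prems by blast
  qed
  then show "hinner (cvec p) (w j) = 0" using x(2) by (auto simp: z_def)
next
  fix p
  assume "p \<in> {x. \<forall>j\<in>{1..CARD('n)}. 0 \<le> Re (lam j) \<longrightarrow> hinner (cvec x) (w j) = 0}"
  then have p: "hinner (cvec p) (w j) = 0" if "j \<in> {1..CARD('n)}" "0 \<le> Re (lam j)" for j
    using that by auto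
  define a where "a j = hinner (cvec p) (w j)" for j
  have "\<exists>Y. (\<forall>t. (Y has_vector_derivative M *v Y t) (at t)) \<and> Y 0 = a j *s v j \<and> (Y \<longlongrightarrow> 0) at_top"
    if j: "j \<in> {1..CARD('n)}" for j
  proof (cases "a j = 0")
    \<comment> \<open>The zero solution covers every index with \<open>Re (lam j) \<ge> 0\<close>,
      where no decaying solution starts at \<open>v j\<close>.\<close>
    case True
    then show ?thesis by (intro exI[of _ "\<lambda>_. 0"]) auto
  next
    case False
    then have "Re (lam j) < 0" using p[OF j] by (force simp: a_def)
    from generalized_eigenvector_solution[OF generalized_eigenvector_basis[OF j] this]
    obtain Y where Y: "\<And>t. (Y has_vector_derivative M *v Y t) (at t)" "Y 0 = v j"
        "(Y \<longlongrightarrow> 0) at_top"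
      by blast
    have lin: "bounded_linear (\<lambda>y. a j *s (y :: complex^'n))"
      unfolding linear_conv_bounded_linear[symmetric]
      by (rule linearI) (simp_all add: vec_eq_iff algebra_simps)
    show ?thesis
      using Y(2) bounded_linear.has_vector_derivative[OF lin Y(1)] bounded_linear.tendsto[OF lin Y(3)]
      by (intro exI[of _ "\<lambda>t. a j *s Y t"]) (simp add: vec.scale)
  qed
  then obtain Y where Y:
      "\<And>j t. j \<in> {1..CARD('n)} \<Longrightarrow> (Y j has_vector_derivative M *v Y j t) (at t)"
      "\<And>j. j \<in> {1..CARD('n)} \<Longrightarrow> Y j 0 = a j *s v j"
      "\<And>j. j \<in> {1..CARD('n)} \<Longrightarrow> (Y j \<longlongrightarrow> 0) at_top"
    by metis
  define Z where "Z t = (\<Sum>j=1..CARD('n). Y j t)" for t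
  have "(Z has_vector_derivative M *v Z t) (at t)" for t
    unfolding Z_def vec.sum by (intro has_vector_derivative_sum Y)
  from bounded_linear.has_vector_derivative[OF bounded_linear_Re_vec this]
  have "trajectory A (\<lambda>t. Re_vec (Z t))"
    by (simp add: trajectory_def M Re_vec_cmat_mult)
  moreover have "Z 0 = cvec p"
    using expansion[of "cvec p"] by (simp add: Z_def Y a_def)
  moreover have "(Z \<longlongrightarrow> 0) at_top"
    unfolding Z_def by (rule tendsto_null_sum) (use Y in auto)
  then have "((\<lambda>t. Re_vec (Z t)) \<longlongrightarrow> 0) at_top"
    using bounded_linear.tendsto_zero[OF bounded_linear_Re_vec] by blast
  ultimately show "p \<in> stable_subspace A"
    by (auto simp: stable_subspace_def intro!: exI[of _ "\<lambda>t. Re_vec (Z t)"])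
qed

end

text \<open>The bases stay the same, so the same functionals describe the unstable subspace.\<close>

lemma dual_jordan_bases_uminus:
  assumes "dual_jordan_bases M lam e v w"
  shows "dual_jordan_bases (- M) (\<lambda>j. - lam j) (\<lambda>j. - e j) v w"
proof -
  interpret dual_jordan_bases M lam e v w by fact
  have "- M *v v j = - lam j *s v j + - e j *s v (j - 1)" if "j \<in> {1..CARD('a)}" for j
    using arg_cong[OF chain[OF that], of uminus] by (simp add: uminus_matrix_vector_mult)
  then show ?thesis
    using dual span superdiag by unfold_locales auto
qed

text \<open>The third set makes the center functionals vanish too: the conditions for
  \<open>j\<close> in \<open>{u+c+1..u+c+s}\<close> alone cut out the sum of the center and unstable
  subspaces, which is larger than the unstable one when \<open>c > 0\<close>.\<close>

theorem proposition3p1: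
  fixes A :: "real^'n^'n"
    and lam :: "nat \<Rightarrow> complex"
    and \<phi> :: "nat \<Rightarrow> real^'n \<Rightarrow> complex"
    and u c s :: nat
  assumes "u + c + s = CARD('n)"
    and "\<forall>j\<in>{1..u}. Re (lam j) > 0"
    and "\<forall>j\<in>{u+1..u+c}. Re (lam j) = 0"
    and "\<forall>j\<in>{u+c+1..u+c+s}. Re (lam j) < 0"
    and "koopman_eigenfunctions A lam \<phi>"
  shows "{x. \<forall>j\<in>{1..u+c}. \<phi> j x = 0} = stable_subspace A \<and>
           {x. \<forall>j\<in>{1..u} \<union> {u+c+1..u+c+s}. \<phi> j x = 0} = center_subspace A \<and>
           {x. \<forall>j\<in>{u+1..u+c+s}. \<phi> j x = 0} = unstable_subspace A"
proof -
  obtain v w where v: "jordan_basis (cmat A) lam v" and w: "dual_basis v w"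
    and \<phi>: "\<And>j x. j \<in> {1..CARD('n)} \<Longrightarrow> \<phi> j x = hinner (cvec x) (w j)"
    using assms(5) by (auto simp: koopman_eigenfunctions_def)
  \<comment> \<open>Equal to 1 exactly where the second alternative of \<open>jordan_basis\<close>
    is forced, and 0 outside the index range as \<open>superdiag\<close> demands.\<close>
  define e :: "nat \<Rightarrow> complex" where
    "e j = (if j \<in> {1..CARD('n)} \<and> cmat A *v v j \<noteq> lam j *s v j then 1 else 0)" for j
  interpret J: dual_jordan_bases "cmat A" lam e v w
  proof
    fix j
    show "vec.span (v ` {1..CARD('n)}) = UNIV" using v by (simp add: jordan_basis_def)
    show "cmat A *v v j = lam j *s v j + e j *s v (j - 1)" if "j \<in> {1..CARD('n)}"
      using v that by (auto simp: jordan_basis_def e_def)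
    show "j \<in> {2..CARD('n)} \<and> lam (j - 1) = lam j" if "e j \<noteq> 0"
    proof -
      from that have "j \<in> {1..CARD('n)}" "cmat A *v v j \<noteq> lam j *s v j"
        by (auto simp: e_def split: if_splits)
      with v show ?thesis unfolding jordan_basis_def by fastforce
    qed
  qed (rule w)
  have sign: "(j \<in> {1..u} \<longrightarrow> Re (lam j) > 0) \<and> (j \<in> {u+1..u+c} \<longrightarrow> Re (lam j) = 0) \<and>
      (j \<in> {u+c+1..u+c+s} \<longrightarrow> Re (lam j) < 0)" for j
    using assms(2-4) by blast
  \<comment> \<open>The three ranges exhaust \<open>{1..CARD('n)}\<close>, so signs of real parts
    determine the index sets. The third line uses \<open>- lam j\<close> because it is matched with
    the stable subspace of \<open>- A\<close>.\<close>
  have index: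
    "j \<in> {1..u+c} \<longleftrightarrow> j \<in> {1..CARD('n)} \<and> Re (lam j) \<ge> 0"
    "j \<in> {1..u} \<union> {u+c+1..u+c+s} \<longleftrightarrow> j \<in> {1..CARD('n)} \<and> Re (lam j) \<noteq> 0"
    "j \<in> {u+1..u+c+s} \<longleftrightarrow> j \<in> {1..CARD('n)} \<and> Re (- lam j) \<ge> 0" for j
    unfolding assms(1)[symmetric] using sign[of j] by (auto simp: not_less_eq_eq)
  have "{x. \<forall>j\<in>{1..u+c}. \<phi> j x = 0} = stable_subspace A"
    unfolding J.stable_subspace_eq[OF refl] Ball_def index using \<phi> by auto
  moreover have "{x. \<forall>j\<in>{1..u} \<union> {u+c+1..u+c+s}. \<phi> j x = 0} = center_subspace A"
    unfolding center_subspace_def J.center_iff Ball_def index using \<phi> by auto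
  moreover have "{x. \<forall>j\<in>{u+1..u+c+s}. \<phi> j x = 0} = unstable_subspace A"
    unfolding stable_subspace_uminus[symmetric] Ball_def index
      dual_jordan_bases.stable_subspace_eq[OF
        dual_jordan_bases_uminus[OF J.dual_jordan_bases_axioms] cmat_uminus[symmetric]]
    using \<phi> by auto
  ultimately show ?thesis by blast
qed

end
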